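(* Let $\mathbb K\in\{\mathbb R,\mathbb C\}$, let $p,q,d,k_\Sigma,k_\Omega,k$ be positive integers and $\varepsilon,\delta\in(0,1)$. Let $\Sigma\in\mathbb K^{k_\Sigma\times p}$ be a $(\varepsilon/4,\delta/(3q),d)$ oblivious $\mathbb K^p\to\mathbb K^{k_\Sigma}$ subspace embedding, let $\Omega\in\mathbb K^{k_\Omega\times q}$ be a $(\varepsilon/4,\delta/(3k_\Sigma),d)$ oblivious $\mathbb K^q\to\mathbb K^{k_\Omega}$ subspace embedding, and let $\Gamma\in\mathbb K^{k\times k_\Sigma k_\Omega}$ be a $(\varepsilon/4,\delta/3,d)$ oblivious $\mathbb K^{k_\Sigma k_\Omega}\to\mathbb K^k$ subspace embedding. Assume that the random matrices $\Sigma$, $\Omega$ and $\Gamma$ are independent. Then the random linear map $\Upsilon:\mathbb K^{q\times p}\to\mathbb K^k$, $\Upsilon(X):=\Gamma\,\mathrm{vec}(\Omega X\Sigma^* )$, is a $(\varepsilon,\delta,d)$ oblivious $\mathbb K^{q\times p}\to\mathbb K^k$ subspace embedding.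
   Context: $M^*$ is the conjugate transpose and $\mathrm{vec}$ stacks the columns of a matrix into a vector. $\mathbb K^n$ carries its canonical inner product and $\mathbb K^{q\times p}$ the Frobenius inner product $\langle X,Y\rangle_F=\mathrm{Tr}(X^*Y)$. For a finite-dimensional inner product space $Z$ over $\mathbb K$, a random linear map $\Theta:Z\to\mathbb K^k$ (a random matrix being identified with the linear map it defines) is called a $(\varepsilon,\delta,d)$ oblivious $Z\to\mathbb K^k$ subspace embedding if for every (deterministic) subspace $Z_d\subset Z$ with $\dim Z_d=d$, $$\mathbb P\big(\forall x,y\in Z_d:\ |\langle x,y\rangle_Z-\langle\Theta(x),\Theta(y)\rangle_2|\le\varepsilon\|x\|_Z\|y\|_Z\big)\ge 1-\delta .$$ This notion is only considered for $1\le d\le\dim Z$, for every embedding appearing in the statement. *)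

theory Defs
  imports
    "HOL-Probability.Probability"
    "Jordan_Normal_Form.Conjugate"
begin

(* The scalars: real or complex numbers. Up to isomorphism these are the only models, because a
   commutative real normed algebra with multiplicative norm is the reals or the complex numbers;
   the last axiom forces conjugate to be the usual conjugation. *)
class real_or_complex = real_normed_field + euclidean_space + conjugatable_field +
  assumes mult_conjugate: "x * conjugate x = (norm x)\<^sup>2 *\<^sub>R 1"

instance real :: real_or_complex
  by standard (simp add: power2_eq_square)

instance complex :: real_or_complex
  by standard (simp add: complex_norm_square scaleR_conv_of_real del: of_real_power)

(* The inner product is conjugate-linear in the first argument, as in Tr (X^* Y). *)
locale scalar_inner_space = vector_space scale
  for scale :: "'k::real_or_complex \<Rightarrow> 'z::ab_group_add \<Rightarrow> 'z" +
  fixes ip :: "'z \<Rightarrow> 'z \<Rightarrow> 'k"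
  assumes ip_add_right: "ip x (y + z) = ip x y + ip x z"
    and ip_scale_right: "ip x (scale c y) = c * ip x y"
    and ip_conjugate: "ip y x = conjugate (ip x y)"
    and ip_nonneg: "ip x x = of_real (norm (ip x x))"
    and ip_definite: "ip x x = 0 \<Longrightarrow> x = 0"
begin

definition ip_norm :: "'z \<Rightarrow> real" where
  "ip_norm x = sqrt (norm (ip x x))"

end

definition vec_inner :: "'k::real_or_complex ^ 'n \<Rightarrow> 'k ^ 'n \<Rightarrow> 'k" where
  "vec_inner x y = (\<Sum>i\<in>UNIV. conjugate (x $ i) * y $ i)"

definition mat_scale :: "'k::real_or_complex \<Rightarrow> 'k ^ 'p ^ 'q \<Rightarrow> 'k ^ 'p ^ 'q" where
  "mat_scale c X = (\<chi> i j. c * X $ i $ j)"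

definition conj_transpose :: "'k::real_or_complex ^ 'p ^ 'q \<Rightarrow> 'k ^ 'q ^ 'p" where
  "conj_transpose X = (\<chi> i j. conjugate (X $ j $ i))"

definition frobenius_inner :: "'k::real_or_complex ^ 'p ^ 'q \<Rightarrow> 'k ^ 'p ^ 'q \<Rightarrow> 'k" where
  "frobenius_inner X Y = trace (conj_transpose X ** Y)"

(* The entry of X in row i and column j is placed at index (j, i): in the lexicographic order of
   the pairs (column, row) this stacks the columns of X on top of each other. *)
definition vec_stack :: "'k ^ 's ^ 'o \<Rightarrow> 'k ^ ('s \<times> 'o)" where
  "vec_stack X = (\<chi> ji. X $ snd ji $ fst ji)"

definition (in scalar_inner_space) random_linear_map ::
    "'w measure \<Rightarrow> ('w \<Rightarrow> 'z \<Rightarrow> 'k ^ 'm) \<Rightarrow> bool" where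
  "random_linear_map M \<Theta> \<longleftrightarrow>
     (\<forall>\<omega>\<in>space M. Vector_Spaces.linear scale (*s) (\<Theta> \<omega>)) \<and>
     (\<forall>x. (\<lambda>\<omega>. \<Theta> \<omega> x) \<in> borel_measurable M)"

(* dim UNIV is 0 for an infinite-dimensional space, so 1 \<le> d \<le> dim UNIV also makes the
   space finite-dimensional. Without d \<le> dim UNIV the condition on subspaces would be vacuous. *)
definition (in scalar_inner_space) oblivious_subspace_embedding ::
    "'w measure \<Rightarrow> real \<Rightarrow> real \<Rightarrow> nat \<Rightarrow> ('w \<Rightarrow> 'z \<Rightarrow> 'k ^ 'm) \<Rightarrow> bool" where
  "oblivious_subspace_embedding M \<epsilon> \<delta> d \<Theta> \<longleftrightarrow>
     1 \<le> d \<and> d \<le> dim UNIV \<and> random_linear_map M \<Theta> \<and>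
     (\<forall>V. subspace V \<and> dim V = d \<longrightarrow>
        measure M {\<omega> \<in> space M. \<forall>x\<in>V. \<forall>y\<in>V.
            norm (ip x y - vec_inner (\<Theta> \<omega> x) (\<Theta> \<omega> y)) \<le> \<epsilon> * ip_norm x * ip_norm y}
          \<ge> 1 - \<delta>)"

(* indep_vars needs a common value type; this is its definition for three variables of
   different types. *)
definition (in prob_space) indep_var3 ::
    "'b measure \<Rightarrow> ('a \<Rightarrow> 'b) \<Rightarrow> 'c measure \<Rightarrow> ('a \<Rightarrow> 'c) \<Rightarrow> 'd measure \<Rightarrow> ('a \<Rightarrow> 'd) \<Rightarrow> bool" where
  "indep_var3 Ma A Mb B Mc C \<longleftrightarrow>
     random_variable Ma A \<and> random_variable Mb B \<and> random_variable Mc C \<and>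
     indep_sets (\<lambda>i. [{A -` S \<inter> space M | S. S \<in> sets Ma},
                      {B -` S \<inter> space M | S. S \<in> sets Mb},
                      {C -` S \<inter> space M | S. S \<in> sets Mc}] ! i) {0, 1, 2}"

lemma vec_inner_self: "vec_inner x x = of_real ((norm x)\<^sup>2)"
proof -
  have "vec_inner x x = (\<Sum>i\<in>UNIV. of_real ((norm (x $ i))\<^sup>2))"
    unfolding vec_inner_def by (intro sum.cong refl) (metis mult.commute mult_conjugate of_real_def)
  then show ?thesis
    by (simp add: norm_vec_def L2_set_def sum_nonneg)
qed

lemma frobenius_inner_rows: "frobenius_inner X Y = (\<Sum>i\<in>UNIV. vec_inner (X $ i) (Y $ i))"
proof -
  have "frobenius_inner X Y = (\<Sum>j\<in>UNIV. \<Sum>i\<in>UNIV. conjugate (X $ i $ j) * Y $ i $ j)"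
    by (simp add: frobenius_inner_def conj_transpose_def trace_def matrix_matrix_mult_def)
  then show ?thesis
    by (subst (asm) sum.swap) (simp add: vec_inner_def)
qed

lemma frobenius_inner_self: "frobenius_inner X X = of_real ((norm X)\<^sup>2)"
  by (simp add: frobenius_inner_rows vec_inner_self norm_vec_def[of X] L2_set_def sum_nonneg)

lemma vec_inner_conjugate: "vec_inner y x = conjugate (vec_inner x y)"
  by (simp add: vec_inner_def sum_conjugate conjugate_dist_mul mult.commute)

global_interpretation vec_ip: scalar_inner_space "(*s)" vec_inner
proof
  fix x y z :: "'a ^ 'b" and c
  show "vec_inner x (y + z) = vec_inner x y + vec_inner x z"
    by (simp add: vec_inner_def algebra_simps sum.distrib)
  show "vec_inner x (c *s y) = c * vec_inner x y"
    by (simp add: vec_inner_def sum_distrib_left ac_simps)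
  show "vec_inner y x = conjugate (vec_inner x y)"
    by (rule vec_inner_conjugate)
  show "vec_inner x x = of_real (norm (vec_inner x x))"
    by (simp add: vec_inner_self norm_power)
  show "vec_inner x x = 0 \<Longrightarrow> x = 0"
    by (simp add: vec_inner_self)
qed

global_interpretation mat_ip: scalar_inner_space mat_scale frobenius_inner
proof
  fix X Y Z :: "'a ^ 'b ^ 'c" and c e :: 'a
  show "mat_scale c (X + Y) = mat_scale c X + mat_scale c Y"
    "mat_scale (c + e) X = mat_scale c X + mat_scale e X"
    "mat_scale c (mat_scale e X) = mat_scale (c * e) X"
    "mat_scale 1 X = X"
    by (simp_all add: mat_scale_def vec_eq_iff algebra_simps)
  show "frobenius_inner X (Y + Z) = frobenius_inner X Y + frobenius_inner X Z"
    by (simp add: frobenius_inner_rows vec_ip.ip_add_right sum.distrib)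
  have "mat_scale c Y $ i = c *s Y $ i" for i
    by (simp add: mat_scale_def vec_eq_iff)
  then show "frobenius_inner X (mat_scale c Y) = c * frobenius_inner X Y"
    by (simp add: frobenius_inner_rows vec_ip.ip_scale_right sum_distrib_left)
  show "frobenius_inner Y X = conjugate (frobenius_inner X Y)"
    by (simp add: frobenius_inner_rows sum_conjugate flip: vec_inner_conjugate)
  show "frobenius_inner X X = of_real (norm (frobenius_inner X X))"
    by (simp add: frobenius_inner_self norm_power)
  show "frobenius_inner X X = 0 \<Longrightarrow> X = 0"
    by (simp add: frobenius_inner_self)
qed

lemma vec_ip_norm_eq: "vec_ip.ip_norm x = norm x"
  by (simp add: vec_ip.ip_norm_def vec_inner_self norm_power)

lemma mat_ip_norm_eq: "mat_ip.ip_norm X = norm X"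
  by (simp add: mat_ip.ip_norm_def frobenius_inner_self norm_power)

end

theory Submission
  imports Defs
begin

text \<open>
  Fix a subspace \<open>V\<close> of matrices with \<open>dim V = d\<close>. The sketch is applied in three stages,
  \<open>X \<mapsto> X \<Sigma>\<^sup>* \<mapsto> \<Omega> X \<Sigma>\<^sup>* \<mapsto> \<Gamma> vec (\<Omega> X \<Sigma>\<^sup>*)\<close>,
  and each stage acts on vectors with one of the given embeddings: \<open>\<Sigma>\<close> on the conjugates of the
  rows of \<open>X\<close>, \<open>\<Omega>\<close> on the columns of \<open>X \<Sigma>\<^sup>*\<close>, and \<open>\<Gamma>\<close> on the single vector
  \<open>vec (\<Omega> X \<Sigma>\<^sup>*)\<close>. The Frobenius inner product is the sum of the inner products of the
  rows, or of the columns, so by the Cauchy-Schwarz inequality a relative error that is bounded for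
  every row or column is bounded for the whole matrix (\<open>relative_error_le_sum\<close>).

  A row or column of the current matrix is a linear or conjugate-linear function of \<open>X\<close>, so as
  \<open>X\<close> varies in \<open>V\<close> it stays in a subspace of dimension at most \<open>d\<close>, hence in one of
  dimension exactly \<open>d\<close> (\<open>image_in_subspace_same_dim\<close>). There are \<open>q\<close> rows, \<open>k\<^sub>\<Sigma>\<close>
  columns and one vector, and the union bound gives failure probability at most \<open>\<delta> / 3\<close> for each
  stage (\<open>embedding_preserves_family\<close>). The subspaces used for \<open>\<Omega>\<close> depend on \<open>\<Sigma>\<close>, and
  those used for \<open>\<Gamma>\<close> on \<open>\<Sigma>\<close> and \<open>\<Omega>\<close>. Independence and Fubini's theorem reduce these
  stages to fixed values of the earlier matrices (\<open>indep_prob_ge\<close>). The events are measurable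
  because they are the preimages of closed sets of matrices.

  If all stages succeed, then their relative errors \<open>e = \<epsilon> / 4\<close> accumulate
  (\<open>relative_error_le_trans\<close>) to \<open>(1 + e)^3 - 1 = e (3 + 3 e + e^2) \<le> 4 e = \<epsilon>\<close>.
\<close>

section \<open>Relative errors between sesquilinear forms\<close>

text \<open>
  The size of \<open>x\<close> is measured by the first form, as \<open>sqrt (norm (b x x))\<close>. Comparing the
  pulled back forms on the one space \<open>V\<close> treats all stages of the sketch alike, although they
  take values in different spaces.
\<close>

definition relative_error_le ::
    "real \<Rightarrow> 'z set \<Rightarrow> ('z \<Rightarrow> 'z \<Rightarrow> 'k::real_normed_vector) \<Rightarrow> ('z \<Rightarrow> 'z \<Rightarrow> 'k) \<Rightarrow> bool" where
  "relative_error_le e V b b' \<longleftrightarrow>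
     (\<forall>x\<in>V. \<forall>y\<in>V. norm (b x y - b' x y) \<le> e * sqrt (norm (b x x)) * sqrt (norm (b y y)))"

lemma relative_error_le_mono:
  assumes "relative_error_le e V b b'" "e \<le> e'"
  shows "relative_error_le e' V b b'"
  unfolding relative_error_le_def
proof (intro ballI)
  fix x y assume "x \<in> V" "y \<in> V"
  then have "norm (b x y - b' x y) \<le> e * sqrt (norm (b x x)) * sqrt (norm (b y y))"
    using assms(1) by (simp add: relative_error_le_def)
  also have "\<dots> \<le> e' * sqrt (norm (b x x)) * sqrt (norm (b y y))"
    by (intro mult_right_mono assms(2)) auto
  finally show "norm (b x y - b' x y) \<le> e' * sqrt (norm (b x x)) * sqrt (norm (b y y))" .
qed

lemma relative_error_le_swap:
  fixes b b' :: "'z \<Rightarrow> 'z \<Rightarrow> 'k::real_normed_vector"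
  shows "relative_error_le e V (\<lambda>x y. b y x) (\<lambda>x y. b' y x) \<longleftrightarrow> relative_error_le e V b b'"
proof -
  have swap: "relative_error_le e V (\<lambda>x y. c y x) (\<lambda>x y. c' y x)"
    if "relative_error_le e V c c'" for c c' :: "'z \<Rightarrow> 'z \<Rightarrow> 'k"
    unfolding relative_error_le_def
  proof (intro ballI)
    fix x y assume "x \<in> V" "y \<in> V"
    then have "norm (c y x - c' y x) \<le> e * sqrt (norm (c y y)) * sqrt (norm (c x x))"
      using that by (simp add: relative_error_le_def)
    then show "norm (c y x - c' y x) \<le> e * sqrt (norm (c x x)) * sqrt (norm (c y y))"
      by (simp only: mult.assoc mult.commute[of "sqrt (norm (c y y))"])
  qed
  show ?thesis
    using swap[of b b'] swap[of "\<lambda>x y. b y x" "\<lambda>x y. b' y x"] by blast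
qed

text \<open>
  On the diagonal the first error bounds \<open>b1 x x\<close> by \<open>(1 + e) * b0 x x\<close> in norm, and this
  factor enlarges the second error.
\<close>

lemma relative_error_le_trans:
  assumes 1: "relative_error_le e V b0 b1" and 2: "relative_error_le e' V b1 b2" and "0 \<le> e" "0 \<le> e'"
  shows "relative_error_le (e + e' * (1 + e)) V b0 b2"
  unfolding relative_error_le_def
proof (intro ballI)
  have growth: "sqrt (norm (b1 x x)) \<le> sqrt (1 + e) * sqrt (norm (b0 x x))" if "x \<in> V" for x
  proof -
    have "norm (b0 x x - b1 x x) \<le> e * norm (b0 x x)"
      using 1[unfolded relative_error_le_def, rule_format, OF that that] by (simp add: mult.assoc)
    then have "norm (b1 x x) \<le> (1 + e) * norm (b0 x x)"
      using norm_triangle_ineq2[of "b1 x x" "b0 x x"] by (simp add: norm_minus_commute algebra_simps)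
    then show ?thesis
      by (simp flip: real_sqrt_mult)
  qed
  fix x y assume xy: "x \<in> V" "y \<in> V"
  have "norm (b1 x y - b2 x y) \<le> e' * (sqrt (norm (b1 x x)) * sqrt (norm (b1 y y)))"
    using 2 xy by (simp add: relative_error_le_def mult.assoc)
  also have "\<dots> \<le> e' * ((sqrt (1 + e) * sqrt (norm (b0 x x))) * (sqrt (1 + e) * sqrt (norm (b0 y y))))"
    using \<open>0 \<le> e\<close> \<open>0 \<le> e'\<close> by (intro mult_left_mono mult_mono growth xy) auto
  also have "\<dots> = e' * (sqrt (1 + e) * sqrt (1 + e)) * sqrt (norm (b0 x x)) * sqrt (norm (b0 y y))"
    by (simp only: ac_simps)
  also have "sqrt (1 + e) * sqrt (1 + e) = 1 + e"
    using \<open>0 \<le> e\<close> by simp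
  finally have "norm (b1 x y - b2 x y) \<le> e' * (1 + e) * sqrt (norm (b0 x x)) * sqrt (norm (b0 y y))" .
  moreover have "norm (b0 x y - b1 x y) \<le> e * sqrt (norm (b0 x x)) * sqrt (norm (b0 y y))"
    using 1 xy by (simp add: relative_error_le_def)
  moreover have "norm (b0 x y - b2 x y) \<le> norm (b0 x y - b1 x y) + norm (b1 x y - b2 x y)"
    by (rule order_trans[OF eq_refl norm_triangle_ineq]) simp
  ultimately show "norm (b0 x y - b2 x y)
      \<le> (e + e' * (1 + e)) * sqrt (norm (b0 x x)) * sqrt (norm (b0 y y))"
    by (simp add: distrib_right)
qed

text \<open>
  The diagonal values are nonnegative reals, so their norms add up without cancellation. The products
  \<open>sqrt (norm (b i x x)) * sqrt (norm (b i y y))\<close> are then summed by the Cauchy-Schwarz inequality.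
\<close>

lemma relative_error_le_sum:
  fixes b b' :: "'i \<Rightarrow> 'z \<Rightarrow> 'z \<Rightarrow> 'k::real_normed_field"
  assumes err: "\<And>i. i \<in> I \<Longrightarrow> relative_error_le e V (b i) (b' i)"
    and nonneg: "\<And>i x. i \<in> I \<Longrightarrow> x \<in> V \<Longrightarrow> b i x x = of_real (norm (b i x x))"
    and "0 \<le> e"
  shows "relative_error_le e V (\<lambda>x y. \<Sum>i\<in>I. b i x y) (\<lambda>x y. \<Sum>i\<in>I. b' i x y)"
  unfolding relative_error_le_def
proof (intro ballI)
  have norm_diagonal: "norm (\<Sum>i\<in>I. b i x x) = (\<Sum>i\<in>I. norm (b i x x))" if "x \<in> V" for x
  proof -
    have "(\<Sum>i\<in>I. b i x x) = of_real (\<Sum>i\<in>I. norm (b i x x))"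
      unfolding of_real_sum using nonneg that by (intro sum.cong refl) simp
    then show ?thesis
      by (simp only: norm_of_real) (simp add: sum_nonneg)
  qed
  fix x y assume xy: "x \<in> V" "y \<in> V"
  let ?n = "\<lambda>i x. sqrt (norm (b i x x))"
  have "norm ((\<Sum>i\<in>I. b i x y) - (\<Sum>i\<in>I. b' i x y)) \<le> (\<Sum>i\<in>I. norm (b i x y - b' i x y))"
    unfolding sum_subtractf[symmetric] by (rule norm_sum)
  also have "\<dots> \<le> (\<Sum>i\<in>I. e * (?n i x * ?n i y))"
    using err xy by (intro sum_mono) (simp add: relative_error_le_def mult.assoc)
  also have "\<dots> = e * (\<Sum>i\<in>I. \<bar>?n i x\<bar> * \<bar>?n i y\<bar>)"
    by (simp add: sum_distrib_left)
  also have "\<dots> \<le> e * (L2_set (\<lambda>i. ?n i x) I * L2_set (\<lambda>i. ?n i y) I)"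
    using \<open>0 \<le> e\<close> by (intro mult_left_mono L2_set_mult_ineq)
  also have "\<dots> = e * sqrt (norm (\<Sum>i\<in>I. b i x x)) * sqrt (norm (\<Sum>i\<in>I. b i y y))"
    by (simp add: L2_set_def norm_diagonal xy mult.assoc)
  finally show "norm ((\<Sum>i\<in>I. b i x y) - (\<Sum>i\<in>I. b' i x y))
      \<le> e * sqrt (norm (\<Sum>i\<in>I. b i x x)) * sqrt (norm (\<Sum>i\<in>I. b i y y))" .
qed

text \<open>
  The condition ranges over possibly uncountably many pairs in \<open>V\<close>. Its parameter set is Borel
  nevertheless, being an intersection of closed sets.
\<close>

lemma closed_relative_error_le:
  fixes b b' :: "'t::topological_space \<Rightarrow> 'z \<Rightarrow> 'z \<Rightarrow> 'k::real_normed_vector"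
  assumes "\<And>x y. continuous_on UNIV (\<lambda>t. b t x y)" "\<And>x y. continuous_on UNIV (\<lambda>t. b' t x y)"
  shows "closed {t. relative_error_le e V (b t) (b' t)}"
proof -
  have "{t. relative_error_le e V (b t) (b' t)} = (\<Inter>x\<in>V. \<Inter>y\<in>V.
      {t. norm (b t x y - b' t x y) \<le> e * sqrt (norm (b t x x)) * sqrt (norm (b t y y))})"
    by (auto simp: relative_error_le_def)
  moreover have "closed \<dots>"
    by (intro closed_INT ballI closed_Collect_le continuous_intros assms)
  ultimately show ?thesis
    by simp
qed

section \<open>Continuity of the matrix operations\<close>

lemma norm_conjugate: "norm (conjugate x) = norm (x :: 'k::real_or_complex)"
proof (cases "x = 0")
  case False
  have "norm x * norm (conjugate x) = norm x * norm x"
    unfolding norm_mult[symmetric] mult_conjugate by (simp add: norm_mult power2_eq_square)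
  then show ?thesis
    using False by simp
qed simp

lemma continuous_on_conjugate [continuous_intros]:
  fixes f :: "'t::topological_space \<Rightarrow> 'k::real_or_complex"
  assumes "continuous_on S f"
  shows "continuous_on S (\<lambda>t. conjugate (f t))"
proof (rule continuous_on_compose2[OF _ assms subset_UNIV])
  have "dist (conjugate x) (conjugate y) = dist x y" for x y :: 'k
    using norm_conjugate[of "x - y"] conjugate_dist_add[of x "- y"] by (simp add: dist_norm conjugate_neg)
  then show "continuous_on UNIV (conjugate :: 'k \<Rightarrow> 'k)"
    unfolding continuous_on_iff by auto
qed

lemma continuous_on_vec_inner [continuous_intros]:
  fixes f g :: "'t::topological_space \<Rightarrow> 'k::real_or_complex ^ 'n"
  assumes "continuous_on S f" "continuous_on S g"
  shows "continuous_on S (\<lambda>t. vec_inner (f t) (g t))"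
  unfolding vec_inner_def by (intro continuous_intros assms)

lemma continuous_on_frobenius_inner [continuous_intros]:
  fixes f g :: "'t::topological_space \<Rightarrow> 'k::real_or_complex ^ 'n ^ 'm"
  assumes "continuous_on S f" "continuous_on S g"
  shows "continuous_on S (\<lambda>t. frobenius_inner (f t) (g t))"
  unfolding frobenius_inner_rows by (intro continuous_intros assms)

lemma continuous_on_conj_transpose [continuous_intros]:
  fixes f :: "'t::topological_space \<Rightarrow> 'k::real_or_complex ^ 'n ^ 'm"
  assumes "continuous_on S f"
  shows "continuous_on S (\<lambda>t. conj_transpose (f t))"
  unfolding conj_transpose_def by (intro continuous_intros assms)

lemma continuous_on_vec_stack [continuous_intros]:
  fixes f :: "'t::topological_space \<Rightarrow> 'k::real_or_complex ^ 'n ^ 'm"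
  assumes "continuous_on S f"
  shows "continuous_on S (\<lambda>t. vec_stack (f t))"
  unfolding vec_stack_def by (intro continuous_intros assms)

lemma continuous_on_matrix_matrix_mult [continuous_intros]:
  fixes f :: "'t::topological_space \<Rightarrow> 'k::real_normed_field ^ 'n ^ 'm" and g :: "'t \<Rightarrow> 'k ^ 'l ^ 'n"
  assumes "continuous_on S f" "continuous_on S g"
  shows "continuous_on S (\<lambda>t. f t ** g t)"
  unfolding matrix_matrix_mult_def by (intro continuous_intros assms)

lemma continuous_on_matrix_vector_mult [continuous_intros]:
  fixes f :: "'t::topological_space \<Rightarrow> 'k::real_normed_field ^ 'n ^ 'm" and g :: "'t \<Rightarrow> 'k ^ 'n"
  assumes "continuous_on S f" "continuous_on S g"
  shows "continuous_on S (\<lambda>t. f t *v g t)"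
  unfolding matrix_vector_mult_def by (intro continuous_intros assms)

section \<open>Subspaces and dimensions\<close>

text \<open>
  An additive map that sends lines into lines maps the span of a set into the span of the image of the
  set. The scalar \<open>c'\<close> may differ from \<open>c\<close> in order to cover conjugate-linear maps.
\<close>

lemma (in vector_space) image_in_subspace_same_dim:
  fixes f :: "'b \<Rightarrow> 'a ^ 'n"
  assumes "dim V = d" "0 < d" "d \<le> vec.dim (UNIV :: ('a ^ 'n) set)"
    and add: "\<And>x y. f (x + y) = f x + f y"
    and scale: "\<And>c x. \<exists>c'. f (scale c x) = c' *s f x"
  obtains U where "vec.subspace U" "vec.dim U = d" "f ` V \<subseteq> U"
proof -
  obtain B where B: "V \<subseteq> span B" "card B = d"
    using basis_exists[of V] assms(1) by metis
  then have "finite B"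
    using \<open>0 < d\<close> card_ge_0_finite by blast
  have f0: "f 0 = 0"
    using add[of 0 0] by (simp only: add_0_left add_cancel_right_right)
  have image: "f x \<in> vec.span (f ` B)" if "x \<in> span B" for x
    using that
  proof (induction rule: span_induct_alt)
    case base
    then show ?case
      by (simp add: f0 vec.span_zero)
  next
    case (step c x y)
    obtain c' where "f (scale c x) = c' *s f x"
      using scale by blast
    moreover have "f x \<in> vec.span (f ` B)"
      using step.hyps by (intro vec.span_base) simp
    ultimately show ?case
      using step.IH by (simp add: add vec.span_add vec.span_scale)
  qed
  obtain C where C: "C \<subseteq> f ` B" "vec.independent C" "f ` B \<subseteq> vec.span C"
    using vec.maximal_independent_subset[of "f ` B"] by metis
  obtain D where D: "C \<subseteq> D" "D \<subseteq> UNIV" "vec.independent D" "UNIV \<subseteq> vec.span D"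
    by (rule vec.maximal_independent_subset_extend[OF subset_UNIV C(2)])
  have "vec.dim (UNIV :: ('a ^ 'n) set) \<le> card D"
    using D(4) vec.finiteI_independent[OF D(3)] by (rule vec.dim_le_card)
  then have "d \<le> card D"
    using assms(3) by simp
  moreover have "card C \<le> d"
    using card_mono[OF _ C(1)] card_image_le[of B f] B(2) \<open>finite B\<close> by simp
  ultimately obtain E where E: "C \<subseteq> E" "E \<subseteq> D" "card E = d"
    using exists_subset_between[of C d D, OF _ _ D(1) vec.finiteI_independent[OF D(3)]] by metis
  show thesis
  proof
    show "vec.subspace (vec.span E)"
      by (rule vec.subspace_span)
    show "vec.dim (vec.span E) = d"
      using vec.dim_span_eq_card_independent[OF vec.independent_mono[OF D(3) E(2)]] E(3) by simp
    have "vec.span (f ` B) \<subseteq> vec.span E"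
      using C(3) vec.span_mono[OF E(1)] by (intro vec.span_minimal vec.subspace_span) blast
    then show "f ` V \<subseteq> vec.span E"
      using image B(1) by (intro image_subsetI) blast
  qed
qed

text \<open>
  Repeating a vector in all rows embeds the vectors into the matrices. Since \<open>dim\<close> is \<open>0\<close> for an
  infinite-dimensional space, the finite dimension of the matrix space has to be established first; it
  follows from the injectivity of \<open>vec_stack\<close>.
\<close>

lemma dim_vec_le_dim_mat:
  "vec.dim (UNIV :: ('k::real_or_complex ^ 'p) set) \<le> mat_ip.dim (UNIV :: ('k ^ 'p ^ 'q) set)"
proof -
  let ?stack = "vec_stack :: 'k ^ 'p ^ 'q \<Rightarrow> _"
  interpret stack: vector_space_pair "mat_scale :: 'k \<Rightarrow> 'k ^ 'p ^ 'q \<Rightarrow> _" "(*s) :: 'k \<Rightarrow> 'k ^ ('p \<times> 'q) \<Rightarrow> _"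
    by unfold_locales
  have stack: "Vector_Spaces.linear mat_scale (*s) ?stack"
    by unfold_locales (simp_all add: vec_stack_def mat_scale_def vec_eq_iff)
  have inj_stack: "inj ?stack"
    by (auto simp: inj_def vec_stack_def vec_eq_iff)
  obtain B :: "('k ^ 'p ^ 'q) set" where B: "mat_ip.independent B" "UNIV \<subseteq> mat_ip.span B"
    using mat_ip.maximal_independent_subset by metis
  have "finite (?stack ` B)"
    using stack.linear_independent_injective_image[OF stack B(1)] inj_stack
    by (intro vec.finiteI_independent) (auto intro: inj_on_subset)
  then have "finite B"
    using inj_stack by (meson finite_imageD inj_on_subset subset_UNIV)
  interpret mat: finite_dimensional_vector_space "mat_scale :: 'k \<Rightarrow> 'k ^ 'p ^ 'q \<Rightarrow> _" B
    by unfold_locales (use \<open>finite B\<close> B in auto)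
  interpret rows: finite_dimensional_vector_space_pair_1 "(*s) :: 'k \<Rightarrow> 'k ^ 'p \<Rightarrow> _" cart_basis
      "mat_scale :: 'k \<Rightarrow> 'k ^ 'p ^ 'q \<Rightarrow> _"
    by unfold_locales
  have rows: "Vector_Spaces.linear (*s) mat_scale (\<lambda>x :: 'k ^ 'p. (\<chi> i. x) :: 'k ^ 'p ^ 'q)"
    by unfold_locales (simp_all add: mat_scale_def vec_eq_iff)
  have "mat_ip.dim (range (\<lambda>x :: 'k ^ 'p. (\<chi> i. x) :: 'k ^ 'p ^ 'q)) = vec.dim (UNIV :: ('k ^ 'p) set)"
    by (rule rows.dim_image_eq[OF rows]) (auto simp: inj_on_def vec_eq_iff)
  then show ?thesis
    using mat.dim_subset[OF subset_UNIV, of "range (\<lambda>x. \<chi> i. x)"] by simp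
qed

section \<open>Probability bounds\<close>

lemma (in prob_space) prob_conj_ge:
  assumes "{\<omega> \<in> space M. P \<omega>} \<in> events" "{\<omega> \<in> space M. Q \<omega>} \<in> events"
    and "prob {\<omega> \<in> space M. P \<omega>} \<ge> 1 - a" "prob {\<omega> \<in> space M. Q \<omega>} \<ge> 1 - b"
  shows "prob {\<omega> \<in> space M. P \<omega> \<and> Q \<omega>} \<ge> 1 - (a + b)"
proof -
  let ?P = "{\<omega> \<in> space M. P \<omega>}" and ?Q = "{\<omega> \<in> space M. Q \<omega>}"
  have "prob (?P \<union> ?Q) = prob ?P + prob (?Q - ?P)"
    by (rule finite_measure_Union') (use assms in auto)
  moreover have "prob (?Q - ?P) = prob ?Q - prob (?P \<inter> ?Q)"
    using finite_measure_Diff'[of ?Q ?P] assms by (simp add: Int_commute)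
  moreover have "?P \<inter> ?Q = {\<omega> \<in> space M. P \<omega> \<and> Q \<omega>}"
    by auto
  ultimately show ?thesis
    using assms(3,4) prob_le_1[of "?P \<union> ?Q"] by simp
qed

lemma (in prob_space) prob_ball_ge:
  assumes "finite I" "\<And>i. i \<in> I \<Longrightarrow> {\<omega> \<in> space M. P i \<omega>} \<in> events"
    and "\<And>i. i \<in> I \<Longrightarrow> prob {\<omega> \<in> space M. P i \<omega>} \<ge> 1 - c"
  shows "prob {\<omega> \<in> space M. \<forall>i\<in>I. P i \<omega>} \<ge> 1 - real (card I) * c"
  using assms
proof (induction I)
  case empty
  then show ?case
    by (simp add: prob_space)
next
  case (insert j I)
  have "{\<omega> \<in> space M. \<forall>i\<in>I. P i \<omega>} \<in> events"
    using insert.hyps(1) insert.prems(1) by (intro sets.sets_Collect_finite_All) auto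
  then have "prob {\<omega> \<in> space M. P j \<omega> \<and> (\<forall>i\<in>I. P i \<omega>)} \<ge> 1 - (c + real (card I) * c)"
    using insert by (intro prob_conj_ge) auto
  then show ?case
    using insert.hyps by (simp add: algebra_simps)
qed

text \<open>
  Independence of two random variables is expressed by these set systems because \<open>indep_var\<close>
  requires both variables to have the same type of values.
\<close>

abbreviation (in prob_space) preimages :: "'b measure \<Rightarrow> ('a \<Rightarrow> 'b) \<Rightarrow> 'a set set" where
  "preimages N X \<equiv> {X -` S \<inter> space M | S. S \<in> sets N}"

text \<open>
  The joint distribution is the product of the distributions of \<open>A\<close> and \<open>B\<close>, and by Fubini's
  theorem its value at \<open>S\<close> is an average over \<open>a\<close> of the probabilities of the slices, each of
  which is at least \<open>r\<close>.
\<close>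

lemma (in prob_space) indep_prob_ge:
  assumes A [measurable]: "A \<in> measurable M Ma" and B [measurable]: "B \<in> measurable M Mb"
    and indep: "indep_set (preimages Ma A) (preimages Mb B)" and S: "S \<in> sets (Ma \<Otimes>\<^sub>M Mb)"
    and ge: "\<And>a. a \<in> space Ma \<Longrightarrow> prob {\<omega> \<in> space M. (a, B \<omega>) \<in> S} \<ge> r"
  shows "prob {\<omega> \<in> space M. (A \<omega>, B \<omega>) \<in> S} \<ge> r"
proof -
  interpret A: prob_space "distr M Ma A" by (rule prob_space_distr) measurable
  interpret B: prob_space "distr M Mb B" by (rule prob_space_distr) measurable
  have distr: "distr M Ma A \<Otimes>\<^sub>M distr M Mb B = distr M (Ma \<Otimes>\<^sub>M Mb) (\<lambda>\<omega>. (A \<omega>, B \<omega>))"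
  proof (rule pair_measure_eqI)
    fix R T assume RT: "R \<in> sets (distr M Ma A)" "T \<in> sets (distr M Mb B)"
    have "(\<lambda>\<omega>. (A \<omega>, B \<omega>)) -` (R \<times> T) \<inter> space M = (A -` R \<inter> space M) \<inter> (B -` T \<inter> space M)"
      by auto
    moreover have "prob ((A -` R \<inter> space M) \<inter> (B -` T \<inter> space M))
        = prob (A -` R \<inter> space M) * prob (B -` T \<inter> space M)"
      using indep RT unfolding indep_sets2_eq sets_distr by blast
    ultimately show "emeasure (distr M Ma A) R * emeasure (distr M Mb B) T
        = emeasure (distr M (Ma \<Otimes>\<^sub>M Mb) (\<lambda>\<omega>. (A \<omega>, B \<omega>))) (R \<times> T)"
      using RT by (simp add: emeasure_distr emeasure_eq_measure ennreal_mult)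
  qed (unfold_locales, simp cong: sets_pair_measure_cong)
  have slice: "emeasure (distr M Mb B) (Pair a -` S) = prob {\<omega> \<in> space M. (a, B \<omega>) \<in> S}" for a
    using sets_Pair1[OF S, of a]
    by (subst emeasure_distr) (auto simp: emeasure_eq_measure intro!: arg_cong[where f=prob])
  have "ennreal r = (\<integral>\<^sup>+a. ennreal r \<partial>distr M Ma A)"
    using A.emeasure_space_1 by simp
  also have "\<dots> \<le> (\<integral>\<^sup>+a. emeasure (distr M Mb B) (Pair a -` S) \<partial>distr M Ma A)"
    by (intro nn_integral_mono) (simp add: slice ennreal_leI ge)
  also have "\<dots> = emeasure (distr M Ma A \<Otimes>\<^sub>M distr M Mb B) S"
    using S by (intro B.emeasure_pair_measure_alt[symmetric]) (simp cong: sets_pair_measure_cong)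
  also have "\<dots> = prob {\<omega> \<in> space M. (A \<omega>, B \<omega>) \<in> S}"
    unfolding distr using S
    by (subst emeasure_distr) (auto simp: emeasure_eq_measure intro!: arg_cong[where f=prob])
  finally show ?thesis
    using ennreal_le_iff[OF measure_nonneg] by blast
qed

lemma Int_stable_preimages: "Int_stable {X -` S \<inter> A | S. S \<in> sets N}"
  unfolding Int_stable_def
proof safe
  fix S T assume "S \<in> sets N" "T \<in> sets N"
  then show "\<exists>R. (X -` S \<inter> A) \<inter> (X -` T \<inter> A) = X -` R \<inter> A \<and> R \<in> sets N"
    by (intro exI[of _ "S \<inter> T"]) auto
qed

lemma (in prob_space) indep_var3_imp_indep_pairs:
  assumes "indep_var3 Ma A Mb B Mc C"
  shows "indep_set (preimages Ma A) (preimages Mb B)"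
    and "indep_set (preimages (Ma \<Otimes>\<^sub>M Mb) (\<lambda>\<omega>. (A \<omega>, B \<omega>))) (preimages Mc C)"
proof -
  define E where "E i = [preimages Ma A, preimages Mb B, preimages Mc C] ! i" for i :: nat
  have A [measurable]: "A \<in> measurable M Ma" and B [measurable]: "B \<in> measurable M Mb"
    and C [measurable]: "C \<in> measurable M Mc" and indep: "indep_sets E {0, 1, 2}"
    using assms unfolding indep_var3_def E_def by auto
  have E: "E 0 = preimages Ma A" "E 1 = preimages Mb B" "E (Suc 0) = preimages Mb B" "E 2 = preimages Mc C"
    by (simp_all add: E_def)
  have stable: "Int_stable (E i)" if "i \<in> {0, 1, 2}" for i
    using that by (auto simp: E Int_stable_preimages)
  show "indep_set (preimages Ma A) (preimages Mb B)"
  proof (rule indep_setI)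
    fix a b assume "a \<in> preimages Ma A" "b \<in> preimages Mb B"
    then show "prob (a \<inter> b) = prob a * prob b"
      using indep_setsD[OF indep, of "{0, 1}" "\<lambda>i. if i = 0 then a else b"] E by (auto simp: Int_commute)
  qed auto
  \<comment> \<open>\<open>N\<close> carries the information given by \<open>A\<close> and \<open>B\<close>; the pair is measurable with respect to it.\<close>
  define N where "N = sigma (space M) (E 0 \<union> E 1)"
  have sets_N: "sets N = sigma_sets (space M) (E 0 \<union> E 1)" and space_N: "space N = space M"
    unfolding N_def by (auto simp: E intro!: sets_measure_of space_measure_of)
  have "A \<in> measurable N Ma" "B \<in> measurable N Mb"
    unfolding measurable_def space_N sets_N
    using measurable_space[OF A] measurable_space[OF B] by (auto simp: E intro!: sigma_sets.Basic)
  then have AB: "(\<lambda>\<omega>. (A \<omega>, B \<omega>)) \<in> measurable N (Ma \<Otimes>\<^sub>M Mb)"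
    by measurable
  have "indep_sets (\<lambda>j. sigma_sets (space M) (\<Union>i\<in>(case j of True \<Rightarrow> {0, 1} | False \<Rightarrow> {2}). E i)) (UNIV :: bool set)"
    by (rule indep_sets_collect_sigma)
       (auto simp: UNIV_bool disjoint_family_on_def split: bool.splits intro!: stable indep_sets_mono_index[OF _ indep])
  then have "indep_set (sigma_sets (space M) (E 0 \<union> E 1)) (sigma_sets (space M) (E 2))"
    unfolding indep_set_def by (rule indep_sets_mono_sets) (auto split: bool.splits)
  moreover have "preimages (Ma \<Otimes>\<^sub>M Mb) (\<lambda>\<omega>. (A \<omega>, B \<omega>)) \<subseteq> sigma_sets (space M) (E 0 \<union> E 1)"
    using measurable_sets[OF AB] by (auto simp: sets_N space_N)
  moreover have "preimages Mc C \<subseteq> sigma_sets (space M) (E 2)"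
    unfolding E by (rule sigma_sets_superset_generator)
  ultimately show "indep_set (preimages (Ma \<Otimes>\<^sub>M Mb) (\<lambda>\<omega>. (A \<omega>, B \<omega>))) (preimages Mc C)"
    unfolding indep_sets2_eq by blast
qed

section \<open>Embedding families of vectors\<close>

text \<open>
  Each \<open>f i\<close> maps \<open>V\<close> into a \<open>d\<close>-dimensional subspace, which \<open>\<Theta>\<close> distorts with
  probability at most \<open>c\<close>. The union bound makes all of these good at once, and their errors combine
  to one error for the sum of the inner products.
\<close>

lemma (in scalar_inner_space) embedding_preserves_family:
  fixes f :: "'i \<Rightarrow> 'z \<Rightarrow> 'k ^ 'n" and \<Theta> :: "'w \<Rightarrow> 'k ^ 'n ^ 'm"
  assumes M: "prob_space M" and meas [measurable]: "\<Theta> \<in> borel_measurable M"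
    and emb: "vec_ip.oblivious_subspace_embedding M e c d (\<lambda>\<omega> x. \<Theta> \<omega> *v x)"
    and "0 \<le> e" "finite I" "dim V = d"
    and add: "\<And>i x y. i \<in> I \<Longrightarrow> f i (x + y) = f i x + f i y"
    and scale: "\<And>i a x. i \<in> I \<Longrightarrow> \<exists>a'. f i (scale a x) = a' *s f i x"
  shows "measure M {\<omega> \<in> space M. relative_error_le e V
            (\<lambda>x y. \<Sum>i\<in>I. vec_inner (f i x) (f i y))
            (\<lambda>x y. \<Sum>i\<in>I. vec_inner (\<Theta> \<omega> *v f i x) (\<Theta> \<omega> *v f i y))}
          \<ge> 1 - real (card I) * c"
proof -
  interpret prob_space M by (rule M)
  have d: "0 < d" "d \<le> vec.dim (UNIV :: ('k ^ 'n) set)"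
    using emb unfolding vec_ip.oblivious_subspace_embedding_def by auto
  have prob_subspace: "prob {\<omega> \<in> space M. \<forall>x\<in>U. \<forall>y\<in>U.
        norm (vec_inner x y - vec_inner (\<Theta> \<omega> *v x) (\<Theta> \<omega> *v y)) \<le> e * vec_ip.ip_norm x * vec_ip.ip_norm y}
      \<ge> 1 - c" if "vec.subspace U" "vec.dim U = d" for U
    using emb that unfolding vec_ip.oblivious_subspace_embedding_def by auto
  let ?good = "\<lambda>I \<omega>. relative_error_le e V (\<lambda>x y. \<Sum>i\<in>I. vec_inner (f i x) (f i y))
            (\<lambda>x y. \<Sum>i\<in>I. vec_inner (\<Theta> \<omega> *v f i x) (\<Theta> \<omega> *v f i y))"
  have event: "{\<omega> \<in> space M. ?good J \<omega>} \<in> events" for J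
  proof -
    have "closed {t. relative_error_le e V (\<lambda>x y. \<Sum>i\<in>J. vec_inner (f i x) (f i y))
            (\<lambda>x y. \<Sum>i\<in>J. vec_inner (t *v f i x) (t *v f i y))}"
      by (intro closed_relative_error_le continuous_intros)
    from measurable_sets[OF meas borel_closed[OF this]] show ?thesis
      by (simp add: vimage_def Int_def conj_commute)
  qed
  have "prob {\<omega> \<in> space M. ?good {i} \<omega>} \<ge> 1 - c" if i: "i \<in> I" for i
  proof -
    obtain U where U: "vec.subspace U" "vec.dim U = d" "f i ` V \<subseteq> U"
      by (rule image_in_subspace_same_dim[OF \<open>dim V = d\<close> d, where f = "f i"])
         (use add[OF i] scale[OF i] in auto)
    show ?thesis
      using prob_subspace[OF U(1,2)] U(3)
      by (elim order_trans, intro finite_measure_mono event)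
         (auto simp: relative_error_le_def vec_ip.ip_norm_def)
  qed
  then have "prob {\<omega> \<in> space M. \<forall>i\<in>I. ?good {i} \<omega>} \<ge> 1 - real (card I) * c"
    using \<open>finite I\<close> event by (intro prob_ball_ge)
  also have "prob {\<omega> \<in> space M. \<forall>i\<in>I. ?good {i} \<omega>} \<le> prob {\<omega> \<in> space M. ?good I \<omega>}"
    using \<open>0 \<le> e\<close> vec_ip.ip_nonneg
    by (intro finite_measure_mono event) (auto intro!: relative_error_le_sum)
  finally show ?thesis .
qed

section \<open>Rows, columns and stacking\<close>

lemma frobenius_inner_columns:
  "frobenius_inner X Y = (\<Sum>j\<in>UNIV. vec_inner (column j X) (column j Y))"
  by (simp add: frobenius_inner_rows vec_inner_def column_def) (rule sum.swap)

lemma column_mult: "column j (A ** X) = A *v column j X"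
  by (simp add: column_def matrix_matrix_mult_def matrix_vector_mult_def vec_eq_iff)

lemma column_mat_scale: "column j (mat_scale c X) = c *s column j X"
  by (simp add: column_def mat_scale_def vec_eq_iff)

lemma vec_inner_vec_stack: "vec_inner (vec_stack X) (vec_stack Y) = frobenius_inner X Y"
proof -
  have "frobenius_inner X Y = (\<Sum>(j, i)\<in>UNIV \<times> UNIV. conjugate (X $ i $ j) * Y $ i $ j)"
    by (simp only: frobenius_inner_columns vec_inner_def column_def vec_lambda_beta sum.cartesian_product)
  then show ?thesis
    by (simp only: vec_inner_def vec_stack_def vec_lambda_beta case_prod_unfold UNIV_Times_UNIV)
qed

text \<open>
  Multiplication by \<open>A\<^sup>*\<close> from the right conjugates the entries of \<open>A\<close>, so \<open>A\<close> itself acts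
  on the conjugates of the rows.
\<close>

definition conj_row :: "'q \<Rightarrow> 'k::real_or_complex ^ 'p ^ 'q \<Rightarrow> 'k ^ 'p" where
  "conj_row i X = (\<chi> j. conjugate (X $ i $ j))"

lemma frobenius_inner_conj_rows:
  "frobenius_inner X Y = (\<Sum>i\<in>UNIV. vec_inner (conj_row i Y) (conj_row i X))"
  by (simp add: frobenius_inner_rows vec_inner_def conj_row_def mult.commute)

lemma conj_row_mult_conj_transpose: "conj_row i (X ** conj_transpose A) = A *v conj_row i X"
  by (simp add: conj_row_def conj_transpose_def matrix_matrix_mult_def matrix_vector_mult_def vec_eq_iff
      sum_conjugate conjugate_dist_mul mult.commute)

lemma mat_scale_matrix_mult: "mat_scale c (A ** X) = A ** mat_scale c X" "mat_scale c (X ** B) = mat_scale c X ** B"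
  by (simp_all add: mat_scale_def matrix_matrix_mult_def vec_eq_iff sum_distrib_left mult.assoc mult.left_commute)

lemma matrix_mult_add_left: "(A + B) ** C = A ** C + B ** C"
  by (simp add: matrix_matrix_mult_def vec_eq_iff sum.distrib distrib_right)

lemma vec_stack_add: "vec_stack (X + Y) = vec_stack X + vec_stack Y"
  by (simp add: vec_stack_def vec_eq_iff)

lemma vec_stack_scale: "vec_stack (mat_scale c X) = c *s vec_stack X"
  by (simp add: vec_stack_def mat_scale_def vec_eq_iff)

section \<open>The two-sided sketch\<close>

theorem proposition3p3:
  fixes M :: "'w measure"
    and \<Sigma> :: "'w \<Rightarrow> 'k::real_or_complex ^ 'p ^ 's"
    and \<Omega> :: "'w \<Rightarrow> 'k ^ 'q ^ 'o"
    and \<Gamma> :: "'w \<Rightarrow> 'k ^ ('s \<times> 'o) ^ 'm"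
    and \<epsilon> \<delta> :: real and d :: nat
  assumes "prob_space M"
    and "0 < \<epsilon>" "\<epsilon> < 1" "0 < \<delta>" "\<delta> < 1"
    and "vec_ip.oblivious_subspace_embedding M (\<epsilon> / 4) (\<delta> / (3 * real CARD('q))) d
           (\<lambda>\<omega> x. \<Sigma> \<omega> *v x)"
    and "vec_ip.oblivious_subspace_embedding M (\<epsilon> / 4) (\<delta> / (3 * real CARD('s))) d
           (\<lambda>\<omega> x. \<Omega> \<omega> *v x)"
    and "vec_ip.oblivious_subspace_embedding M (\<epsilon> / 4) (\<delta> / 3) d
           (\<lambda>\<omega> x. \<Gamma> \<omega> *v x)"
    and "prob_space.indep_var3 M borel \<Sigma> borel \<Omega> borel \<Gamma>"
  shows "mat_ip.oblivious_subspace_embedding M \<epsilon> \<delta> d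
           (\<lambda>\<omega> X. \<Gamma> \<omega> *v vec_stack (\<Omega> \<omega> ** X ** conj_transpose (\<Sigma> \<omega>)))"
proof -
  interpret prob_space M by (rule assms(1))
  define e where "e = \<epsilon> / 4"
  have e: "0 \<le> e" "e < 1 / 4"
    using assms by (auto simp: e_def)
  note embeddings = assms(6-8)[folded e_def]
  note indep = indep_var3_imp_indep_pairs[OF assms(9)]
  have \<Sigma> [measurable]: "\<Sigma> \<in> borel_measurable M" and \<Omega> [measurable]: "\<Omega> \<in> borel_measurable M"
    and \<Gamma> [measurable]: "\<Gamma> \<in> borel_measurable M"
    using assms(9) by (auto simp: indep_var3_def)
  have dim: "1 \<le> d" "d \<le> mat_ip.dim (UNIV :: ('k ^ 'p ^ 'q) set)"
    using embeddings(1) dim_vec_le_dim_mat[where ?'k='k and ?'p='p and ?'q='q]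
    by (auto simp: vec_ip.oblivious_subspace_embedding_def)
  \<comment> \<open>The three matrices are kept as one argument, so that every event of interest is the preimage of
    a closed set of triples.\<close>
  define sketch :: "(('k ^ 'p ^ 's) \<times> ('k ^ 'q ^ 'o)) \<times> ('k ^ ('s \<times> 'o) ^ 'm) \<Rightarrow> 'k ^ 'p ^ 'q \<Rightarrow> 'k ^ 'm" where
    "sketch t X = snd t *v vec_stack (snd (fst t) ** X ** conj_transpose (fst (fst t)))" for t X
  have linear: "Vector_Spaces.linear mat_scale (*s) (sketch t)" for t
    by unfold_locales (simp_all add: sketch_def matrix_add_ldistrib matrix_mult_add_left
        vec_stack_add matrix_vector_right_distrib vec_stack_scale
        vec.scale flip: mat_scale_matrix_mult)
  have sketch_continuous: "continuous_on UNIV (\<lambda>t. sketch t X)" for X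
    unfolding sketch_def by (intro continuous_intros)
  have all [measurable]: "(\<lambda>\<omega>. ((\<Sigma> \<omega>, \<Omega> \<omega>), \<Gamma> \<omega>)) \<in> borel_measurable M"
    by (intro borel_measurable_Pair \<Sigma> \<Omega> \<Gamma>)
  have event: "{\<omega> \<in> space M. relative_error_le c V (b ((\<Sigma> \<omega>, \<Omega> \<omega>), \<Gamma> \<omega>)) (b' ((\<Sigma> \<omega>, \<Omega> \<omega>), \<Gamma> \<omega>))} \<in> events"
    if "\<And>x y. continuous_on UNIV (\<lambda>t. b t x y)" "\<And>x y. continuous_on UNIV (\<lambda>t. b' t x y)"
    for c V and b b' :: "_ \<Rightarrow> 'k ^ 'p ^ 'q \<Rightarrow> 'k ^ 'p ^ 'q \<Rightarrow> 'k"
    using measurable_sets[OF all borel_closed[OF closed_relative_error_le[of b b' c V, OF that]]]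
    by (simp add: vimage_def Int_def conj_commute)
  have "prob {\<omega> \<in> space M. relative_error_le \<epsilon> V frobenius_inner
      (\<lambda>X Y. vec_inner (sketch ((\<Sigma> \<omega>, \<Omega> \<omega>), \<Gamma> \<omega>) X) (sketch ((\<Sigma> \<omega>, \<Omega> \<omega>), \<Gamma> \<omega>) Y))} \<ge> 1 - \<delta>"
    if dimV: "mat_ip.dim V = d" for V
  proof -
    \<comment> \<open>The inner products after each of the three stages, pulled back to \<open>V\<close>.\<close>
    define b1 where "b1 t = (\<lambda>X Y :: 'k ^ 'p ^ 'q. frobenius_inner (X ** conj_transpose (fst (fst t))) (Y ** conj_transpose (fst (fst t))))"
      for t :: "(('k ^ 'p ^ 's) \<times> ('k ^ 'q ^ 'o)) \<times> ('k ^ ('s \<times> 'o) ^ 'm)"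
    define b2 where "b2 t = (\<lambda>X Y :: 'k ^ 'p ^ 'q. frobenius_inner (snd (fst t) ** X ** conj_transpose (fst (fst t)))
        (snd (fst t) ** Y ** conj_transpose (fst (fst t))))"
      for t :: "(('k ^ 'p ^ 's) \<times> ('k ^ 'q ^ 'o)) \<times> ('k ^ ('s \<times> 'o) ^ 'm)"
    define b3 where "b3 t = (\<lambda>X Y. vec_inner (sketch t X) (sketch t Y))" for t
    let ?t = "\<lambda>\<omega>. ((\<Sigma> \<omega>, \<Omega> \<omega>), \<Gamma> \<omega>)"
    have cont: "continuous_on UNIV (\<lambda>t. b1 t X Y)" "continuous_on UNIV (\<lambda>t. b2 t X Y)"
      "continuous_on UNIV (\<lambda>t. b3 t X Y)" for X Y
      unfolding b1_def b2_def b3_def by (intro continuous_intros sketch_continuous)+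

    \<comment> \<open>The arguments are swapped because conjugating both vectors swaps them in the inner product.\<close>
    have 1: "prob {\<omega> \<in> space M. relative_error_le e V frobenius_inner (b1 (?t \<omega>))} \<ge> 1 - \<delta> / 3"
    proof -
      have "prob {\<omega> \<in> space M. relative_error_le e V
          (\<lambda>Y X. \<Sum>i\<in>UNIV. vec_inner (conj_row i Y) (conj_row i X))
          (\<lambda>Y X. \<Sum>i\<in>UNIV. vec_inner (\<Sigma> \<omega> *v conj_row i Y) (\<Sigma> \<omega> *v conj_row i X))}
        \<ge> 1 - real CARD('q) * (\<delta> / (3 * real CARD('q)))"
      proof (rule mat_ip.embedding_preserves_family[OF assms(1) \<Sigma> embeddings(1) e(1) finite dimV])
        fix i :: 'q and a and X Y :: "'k ^ 'p ^ 'q"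
        show "conj_row i (X + Y) = conj_row i X + conj_row i Y"
          by (simp add: conj_row_def vec_eq_iff conjugate_dist_add)
        have "conj_row i (mat_scale a X) = conjugate a *s conj_row i X"
          by (simp add: conj_row_def mat_scale_def vec_eq_iff conjugate_dist_mul)
        then show "\<exists>a'. conj_row i (mat_scale a X) = a' *s conj_row i X" ..
      qed
      then show ?thesis
        by (subst relative_error_le_swap[symmetric])
           (simp add: b1_def frobenius_inner_conj_rows conj_row_mult_conj_transpose)
    qed

    \<comment> \<open>\<open>b1\<close> and \<open>b2\<close> do not depend on the last matrix, so \<open>0\<close> can be inserted for it.\<close>
    have 2: "prob {\<omega> \<in> space M. relative_error_le e V (b1 (?t \<omega>)) (b2 (?t \<omega>))} \<ge> 1 - \<delta> / 3"
    proof -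
      let ?S = "{p. relative_error_le e V (b1 (p, 0)) (b2 (p, 0))}"
      have "prob {\<omega> \<in> space M. (\<Sigma> \<omega>, \<Omega> \<omega>) \<in> ?S} \<ge> 1 - \<delta> / 3"
      proof (rule indep_prob_ge[OF \<Sigma> \<Omega> indep(1)])
        have "closed ?S"
          by (rule closed_relative_error_le; rule continuous_on_compose2[OF cont(1)] continuous_on_compose2[OF cont(2)])
             (auto intro!: continuous_intros)
        then show "?S \<in> sets (borel \<Otimes>\<^sub>M borel)"
          unfolding borel_prod by (rule borel_closed)
        fix \<sigma> :: "'k ^ 'p ^ 's"
        have "prob {\<omega> \<in> space M. relative_error_le e V
            (\<lambda>X Y. \<Sum>j\<in>UNIV. vec_inner (column j (X ** conj_transpose \<sigma>)) (column j (Y ** conj_transpose \<sigma>)))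
            (\<lambda>X Y. \<Sum>j\<in>UNIV. vec_inner (\<Omega> \<omega> *v column j (X ** conj_transpose \<sigma>)) (\<Omega> \<omega> *v column j (Y ** conj_transpose \<sigma>)))}
          \<ge> 1 - real CARD('s) * (\<delta> / (3 * real CARD('s)))"
        proof (rule mat_ip.embedding_preserves_family[OF assms(1) \<Omega> embeddings(2) e(1) finite dimV])
          fix j :: 's and a and X Y :: "'k ^ 'p ^ 'q"
          show "column j ((X + Y) ** conj_transpose \<sigma>)
              = column j (X ** conj_transpose \<sigma>) + column j (Y ** conj_transpose \<sigma>)"
            by (simp add: matrix_mult_add_left column_def vec_eq_iff)
          have "column j (mat_scale a X ** conj_transpose \<sigma>) = a *s column j (X ** conj_transpose \<sigma>)"
            by (simp add: column_mat_scale flip: mat_scale_matrix_mult)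
          then show "\<exists>a'. column j (mat_scale a X ** conj_transpose \<sigma>) = a' *s column j (X ** conj_transpose \<sigma>)" ..
        qed
        then show "prob {\<omega> \<in> space M. (\<sigma>, \<Omega> \<omega>) \<in> ?S} \<ge> 1 - \<delta> / 3"
          by (simp add: b1_def b2_def frobenius_inner_columns column_mult flip: matrix_mul_assoc)
      qed
      then show ?thesis
        by (simp add: b1_def b2_def)
    qed

    \<comment> \<open>A family of one vector; its index is the only element of the unit type.\<close>
    have 3: "prob {\<omega> \<in> space M. relative_error_le e V (b2 (?t \<omega>)) (b3 (?t \<omega>))} \<ge> 1 - \<delta> / 3"
    proof -
      let ?S = "{t. relative_error_le e V (b2 t) (b3 t)}"
      have "prob {\<omega> \<in> space M. ((\<Sigma> \<omega>, \<Omega> \<omega>), \<Gamma> \<omega>) \<in> ?S} \<ge> 1 - \<delta> / 3"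
      proof (rule indep_prob_ge[OF _ \<Gamma> indep(2)])
        have "closed ?S"
          by (intro closed_relative_error_le cont)
        then show "?S \<in> sets ((borel \<Otimes>\<^sub>M borel) \<Otimes>\<^sub>M borel)"
          unfolding borel_prod by (rule borel_closed)
        show "(\<lambda>\<omega>. (\<Sigma> \<omega>, \<Omega> \<omega>)) \<in> measurable M (borel \<Otimes>\<^sub>M borel)"
          by measurable
        fix p :: "('k ^ 'p ^ 's) \<times> ('k ^ 'q ^ 'o)"
        let ?f = "\<lambda>X. vec_stack (snd p ** X ** conj_transpose (fst p))"
        have "prob {\<omega> \<in> space M. relative_error_le e V
            (\<lambda>X Y. \<Sum>i\<in>{()}. vec_inner (?f X) (?f Y))
            (\<lambda>X Y. \<Sum>i\<in>{()}. vec_inner (\<Gamma> \<omega> *v ?f X) (\<Gamma> \<omega> *v ?f Y))} \<ge> 1 - real (card {()}) * (\<delta> / 3)"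
        proof (rule mat_ip.embedding_preserves_family[OF assms(1) \<Gamma> embeddings(3) e(1) finite dimV])
          fix a and X Y :: "'k ^ 'p ^ 'q"
          show "?f (X + Y) = ?f X + ?f Y"
            by (simp add: matrix_add_ldistrib matrix_mult_add_left vec_stack_add)
          have "?f (mat_scale a X) = a *s ?f X"
            by (simp add: vec_stack_scale flip: mat_scale_matrix_mult)
          then show "\<exists>a'. ?f (mat_scale a X) = a' *s ?f X" ..
        qed
        then show "prob {\<omega> \<in> space M. (p, \<Gamma> \<omega>) \<in> ?S} \<ge> 1 - \<delta> / 3"
          by (simp add: b2_def b3_def sketch_def vec_inner_vec_stack)
      qed
      then show ?thesis
        by simp
    qed

    have events: "{\<omega> \<in> space M. relative_error_le e V frobenius_inner (b1 (?t \<omega>))} \<in> events"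
      "{\<omega> \<in> space M. relative_error_le e V (b1 (?t \<omega>)) (b2 (?t \<omega>))} \<in> events"
      "{\<omega> \<in> space M. relative_error_le e V (b2 (?t \<omega>)) (b3 (?t \<omega>))} \<in> events"
      "{\<omega> \<in> space M. relative_error_le \<epsilon> V frobenius_inner (b3 (?t \<omega>))} \<in> events"
      by (rule event; intro cont continuous_intros)+
    have "1 - (\<delta> / 3 + (\<delta> / 3 + \<delta> / 3)) \<le> prob {\<omega> \<in> space M. relative_error_le e V frobenius_inner (b1 (?t \<omega>)) \<and>
        relative_error_le e V (b1 (?t \<omega>)) (b2 (?t \<omega>)) \<and> relative_error_le e V (b2 (?t \<omega>)) (b3 (?t \<omega>))}"
      using 1 2 3 events by (intro prob_conj_ge sets.sets_Collect_conj)
    also have "\<dots> \<le> prob {\<omega> \<in> space M. relative_error_le \<epsilon> V frobenius_inner (b3 (?t \<omega>))}"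
    proof (rule finite_measure_mono[OF _ events(4)], safe)
      fix \<omega>
      assume "relative_error_le e V frobenius_inner (b1 (?t \<omega>))"
        "relative_error_le e V (b1 (?t \<omega>)) (b2 (?t \<omega>))" and last: "relative_error_le e V (b2 (?t \<omega>)) (b3 (?t \<omega>))"
      then have "relative_error_le (e + e * (1 + e)) V frobenius_inner (b2 (?t \<omega>))"
        using relative_error_le_trans e by blast
      then have "relative_error_le (e + e * (1 + e) + e * (1 + (e + e * (1 + e)))) V frobenius_inner (b3 (?t \<omega>))"
        using relative_error_le_trans last e by fastforce
      \<comment> \<open>With \<open>e < 1 / 4\<close> the terms of higher order in \<open>(1 + e)^3 - 1\<close> are at most \<open>e\<close>.\<close>
      moreover have "e * (3 * e + e * e) \<le> e * 1"
        using e mult_mono[of e "1/4" e "1/4"] by (intro mult_left_mono) auto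
      ultimately show "relative_error_le \<epsilon> V frobenius_inner (b3 (?t \<omega>))"
        by (elim relative_error_le_mono) (simp add: e_def algebra_simps)
    qed
    finally show ?thesis
      by (simp add: b3_def)
  qed
  moreover have "(\<lambda>\<omega>. sketch ((\<Sigma> \<omega>, \<Omega> \<omega>), \<Gamma> \<omega>) X) \<in> borel_measurable M" for X
    by (rule borel_measurable_continuous_on[OF sketch_continuous all])
  ultimately show ?thesis
    using dim linear[of "((\<Sigma> \<omega>, \<Omega> \<omega>), \<Gamma> \<omega>)" for \<omega>]
    unfolding mat_ip.oblivious_subspace_embedding_def mat_ip.random_linear_map_def relative_error_le_def
      mat_ip.ip_norm_def sketch_def by simp
qed

end
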